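(* Let $G$ be an $n$-vertex graph of maximum degree $3$ that arises from a binary tree by replacing its vertices by cycles, and let $S$ be an $n \times n$ grid point set. Then $G$ admits a restricted RAC$_1$ embedding on $S$.
   Context: "Arising from a binary tree by replacing its vertices by cycles" means: there is a binary tree $T$ such that $G$ is obtained by replacing each vertex $t$ of $T$ by a cycle $C_t$ (with at least 3 vertices), and each edge $st$ of $T$ by an edge joining some vertex of $C_s$ to some vertex of $C_t$; the resulting graph $G$ has maximum degree 3. An $n \times n$ grid point set is a set $S$ of $n$ points with integer coordinates in $\{1,\dots,n\}^2$ such that no two points of $S$ lie on a common horizontal or a common vertical line. A point-set embedding of an $n$-vertex graph $G=(V,E)$ on $S$ consists of a bijection $\mu: V \to S$ and a polyline drawing of $G$ in which each vertex $v$ is drawn at $\mu(v)$ and each edge is a polygonal chain between the images of its endpoints; edges may not overlap and may not pass through points representing other vertices. A restricted RAC$_1$ embedding is such an embedding in which every bend lies on an integer grid point, every edge segment is horizontal or vertical (lies on a grid line), every edge has at most one bend, and any two crossing edges cross at a right angle. The bijection $\mu$ may be chosen freely. *)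

theory Defs
  imports "HOL-Analysis.Analysis"
begin

definition simple_graph :: "'a set \<Rightarrow> 'a set set \<Rightarrow> bool" where
  "simple_graph V E \<longleftrightarrow> finite V \<and> (\<forall>e\<in>E. e \<subseteq> V \<and> card e = 2)"

definition vertex_degree :: "'a set set \<Rightarrow> 'a \<Rightarrow> nat" where
  "vertex_degree E v = card {e\<in>E. v \<in> e}"

text \<open>\<open>A\<close> consists of the pairs (parent, child). Acyclicity follows from reachability
  from the root together with uniqueness of parents.\<close>

definition binary_tree :: "'t set \<Rightarrow> 't \<Rightarrow> ('t \<times> 't) set \<Rightarrow> bool" where
  "binary_tree N r A \<longleftrightarrow>
     finite N \<and> r \<in> N \<and> A \<subseteq> N \<times> N \<and>
     (\<forall>t\<in>N. (r, t) \<in> A\<^sup>*) \<and>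
     (\<forall>s. (s, r) \<notin> A) \<and>
     (\<forall>t\<in>N - {r}. \<exists>!s. (s, t) \<in> A) \<and>
     (\<forall>s\<in>N. card (A `` {s}) \<le> 2)"

definition is_cycle :: "'a set \<Rightarrow> 'a set set \<Rightarrow> bool" where
  "is_cycle C F \<longleftrightarrow>
     (\<exists>xs. distinct xs \<and> length xs \<ge> 3 \<and> C = set xs \<and>
        F = {{xs ! i, xs ! (Suc i mod length xs)} | i. i < length xs})"

definition arises_by_cycle_replacement ::
    "'t set \<Rightarrow> ('t \<times> 't) set \<Rightarrow> 'a set \<Rightarrow> 'a set set \<Rightarrow> bool" where
  "arises_by_cycle_replacement N A V E \<longleftrightarrow>
     (\<exists>C F x y.
        (\<forall>t\<in>N. is_cycle (C t) (F t)) \<and>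
        disjoint_family_on C N \<and>
        (\<forall>(s, t)\<in>A. x s t \<in> C s \<and> y s t \<in> C t) \<and>
        V = (\<Union>t\<in>N. C t) \<and>
        E = (\<Union>t\<in>N. F t) \<union> {{x s t, y s t} | s t. (s, t) \<in> A})"

type_synonym point = "real \<times> real"

definition grid_point_set :: "nat \<Rightarrow> point set \<Rightarrow> bool" where
  "grid_point_set n S \<longleftrightarrow>
     S \<subseteq> (real ` {1..n}) \<times> (real ` {1..n}) \<and> card S = n \<and> inj_on fst S \<and> inj_on snd S"

text \<open>A polygonal chain is given by the list of its corners: the two end points and, between
  them, the bends.\<close>

definition segments :: "point list \<Rightarrow> (point \<times> point) list" where
  "segments p = zip p (tl p)"

definition bends :: "point list \<Rightarrow> point list" where
  "bends p = butlast (tl p)"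

definition curve :: "point list \<Rightarrow> point set" where
  "curve p = (\<Union>(a, b)\<in>set (segments p). closed_segment a b)"

text \<open>Chains are simple: two segments meet only if they are consecutive, and then only in their
  common corner.\<close>

definition polygonal_chain :: "point list \<Rightarrow> bool" where
  "polygonal_chain p \<longleftrightarrow>
     length p \<ge> 2 \<and> distinct p \<and>
     (\<forall>i j. i < j \<and> Suc j < length p \<longrightarrow>
        closed_segment (p ! i) (p ! Suc i) \<inter> closed_segment (p ! j) (p ! Suc j)
          \<subseteq> (if j = Suc i then {p ! j} else {}))"

definition overlap :: "point list \<Rightarrow> point list \<Rightarrow> bool" where
  "overlap p q \<longleftrightarrow> (\<exists>a b. a \<noteq> b \<and> closed_segment a b \<subseteq> curve p \<inter> curve q)"

text \<open>\<open>\<mu>\<close> places the vertices, \<open>D\<close> draws the (undirected) edges; the direction in which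
  \<open>D e\<close> traverses \<open>e\<close> is immaterial.\<close>

definition point_set_embedding ::
    "'a set \<Rightarrow> 'a set set \<Rightarrow> point set \<Rightarrow> ('a \<Rightarrow> point) \<Rightarrow> ('a set \<Rightarrow> point list) \<Rightarrow> bool" where
  "point_set_embedding V E S \<mu> D \<longleftrightarrow>
     bij_betw \<mu> V S \<and>
     (\<forall>e\<in>E. polygonal_chain (D e) \<and> {hd (D e), last (D e)} = \<mu> ` e) \<and>
     (\<forall>e\<in>E. \<forall>f\<in>E. e \<noteq> f \<longrightarrow> \<not> overlap (D e) (D f)) \<and>
     (\<forall>e\<in>E. \<forall>v\<in>V - e. \<mu> v \<notin> curve (D e))"

definition right_angle_crossing :: "point list \<Rightarrow> point list \<Rightarrow> point \<Rightarrow> bool" where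
  "right_angle_crossing p q z \<longleftrightarrow>
     (\<exists>(a, b)\<in>set (segments p). \<exists>(c, d)\<in>set (segments q).
        z \<in> open_segment a b \<and> z \<in> open_segment c d \<and> (b - a) \<bullet> (d - c) = 0)"

text \<open>Every common point of two edges other than a shared end vertex counts as a crossing, so
  that touching at a bend is excluded as well.\<close>

definition restricted_RAC1_embedding ::
    "'a set \<Rightarrow> 'a set set \<Rightarrow> point set \<Rightarrow> ('a \<Rightarrow> point) \<Rightarrow> ('a set \<Rightarrow> point list) \<Rightarrow> bool" where
  "restricted_RAC1_embedding V E S \<mu> D \<longleftrightarrow>
     point_set_embedding V E S \<mu> D \<and>
     (\<forall>e\<in>E. length (bends (D e)) \<le> 1) \<and>
     (\<forall>e\<in>E. \<forall>b\<in>set (bends (D e)). fst b \<in> \<int> \<and> snd b \<in> \<int>) \<and>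
     (\<forall>e\<in>E. \<forall>(a, b)\<in>set (segments (D e)). fst a = fst b \<or> snd a = snd b) \<and>
     (\<forall>e\<in>E. \<forall>f\<in>E. e \<noteq> f \<longrightarrow>
        (\<forall>z \<in> curve (D e) \<inter> curve (D f) - \<mu> ` (e \<inter> f). right_angle_crossing (D e) (D f) z))"

end

theory Submission imports Defs begin

text \<open>
  As no two points share a coordinate, every edge is drawn as an elbow that leaves one end vertex
  horizontally and the other one vertically, and the drawing is a restricted RAC\<open>\<^sub>1\<close> embedding as soon
  as no port (left, right, up, down) of a vertex is used twice. Each cycle is oriented cyclically,
  every vertex \<open>v\<close> being reached vertically from its predecessor, so that a horizontal and a vertical
  port remain at each vertex.

  By induction on the tree, the part of \<open>G\<close> below a cycle can be drawn on any point set of the right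
  size such that the vertex \<open>y\<close> linked to the parent cycle keeps a free vertical port towards a
  prescribed height \<open>h\<close>. The lowest points are given to the subtree hanging at \<open>a\<close>, the highest ones to
  the subtree hanging at \<open>b\<close>, and on the points between them \<open>a\<close> is placed lowest and \<open>b\<close> highest, so
  that \<open>a\<close> has its lower and \<open>b\<close> its upper port free. Choosing the direction of the cycle, one
  can put \<open>y\<close> between its predecessor and \<open>h\<close>. The subtrees are attached by edges that are vertical at
  \<open>a\<close> and \<open>b\<close> and horizontal at the subtrees, to which the induction hypothesis applies with the two
  coordinates exchanged.
\<close>

section \<open>Finite sets: completing partial placements and splitting off extreme points\<close>

lemma bij_betw_extend_partial:
  assumes "finite C" "finite K" "card C = card K" "D \<subseteq> C" "inj_on g D" "g ` D \<subseteq> K"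
  obtains f where "bij_betw f C K" "\<And>d. d \<in> D \<Longrightarrow> f d = g d"
proof -
  have fin: "finite D" "finite (C - D)" "finite (K - g ` D)" using assms finite_subset by auto
  have "card (C - D) = card (K - g ` D)"
    using assms fin by (simp add: card_Diff_subset card_image)
  then obtain h where h: "bij_betw h (C - D) (K - g ` D)"
    using fin finite_same_card_bij by blast
  let ?f = "\<lambda>x. if x \<in> D then g x else h x"
  have "bij_betw ?f D (g ` D)" using assms(5) by (auto simp: bij_betw_def inj_on_def)
  moreover have "bij_betw ?f (C - D) (K - g ` D)"
    using h by (subst bij_betw_cong[where g = h]) auto
  ultimately have "bij_betw ?f (D \<union> (C - D)) (g ` D \<union> (K - g ` D))"
    by (rule bij_betw_combine) auto
  moreover have "D \<union> (C - D) = C" "g ` D \<union> (K - g ` D) = K" using assms by auto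
  ultimately show thesis using that[of ?f] by auto
qed

text \<open>Add the minimum of the remaining points one at a time; injectivity of \<open>Y\<close>
  makes the inequality strict. Applied to the negated coordinate, the lemma yields the highest
  points.\<close>

lemma obtain_lowest:
  fixes Y :: "'p \<Rightarrow> real"
  assumes "finite P" "inj_on Y P" "n \<le> card P"
  obtains Q where "Q \<subseteq> P" "card Q = n" "\<And>q p. q \<in> Q \<Longrightarrow> p \<in> P - Q \<Longrightarrow> Y q < Y p"
proof -
  have "\<exists>Q\<subseteq>P. card Q = n \<and> (\<forall>q\<in>Q. \<forall>p\<in>P - Q. Y q < Y p)"
    using assms(3)
  proof (induction n)
    case 0
    show ?case by (rule exI[of _ "{}"]) simp
  next
    case (Suc n)
    then obtain Q where Q: "Q \<subseteq> P" "card Q = n" "\<forall>q\<in>Q. \<forall>p\<in>P - Q. Y q < Y p" by auto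
    have fQ: "finite Q" using Q assms finite_subset by auto
    have "P - Q \<noteq> {}" using Q Suc.prems fQ by (metis Diff_eq_empty_iff card_mono Suc_n_not_le_n le_trans)
    moreover have "finite (P - Q)" using assms by auto
    ultimately obtain m where m: "m \<in> P - Q" "\<forall>p\<in>P - Q. Y m \<le> Y p"
      by (metis arg_min_least arg_min_if_finite(1))
    have lt: "Y m < Y p" if "p \<in> P - Q" "p \<noteq> m" for p
    proof -
      have "Y m \<noteq> Y p" using assms(2) that m(1) by (auto dest: inj_onD)
      then show ?thesis using m(2) that by force
    qed
    show ?case
      by (rule exI[of _ "insert m Q"]) (use Q m lt fQ in auto)
  qed
  then show thesis using that by blast
qed

section \<open>Cycles: their two orientations and their placement\<close>

lemma is_cycle_card:
  assumes "is_cycle C F"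
  shows "finite C" "card C \<ge> 3"
  using assms by (auto simp: is_cycle_def distinct_card)

text \<open>A cycle has two orientations: \<open>q\<close> is the successor along the list and
  \<open>p\<close> its inverse. Either may serve as the predecessor function, since both generate
  the same edges.\<close>

lemma cycle_predecessors:
  assumes "is_cycle C F"
  obtains p q where "inj_on p C" "inj_on q C" "p ` C = C" "q ` C = C"
    "F = (\<lambda>v. {p v, v}) ` C" "F = (\<lambda>v. {q v, v}) ` C"
    "\<And>v. v \<in> C \<Longrightarrow> p v \<noteq> v \<and> q v \<noteq> v \<and> p v \<noteq> q v"
proof -
  from assms obtain xs where xs: "distinct xs" "length xs \<ge> 3" "C = set xs"
    "F = {{xs ! i, xs ! (Suc i mod length xs)} | i. i < length xs}"
    unfolding is_cycle_def by blast
  let ?k = "length xs"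
  have b: "bij_betw ((!) xs) {..<?k} C" using xs by (simp add: bij_betw_nth)
  define ix where "ix = the_inv_into {..<?k} ((!) xs)"
  have ix: "ix (xs ! i) = i" if "i < ?k" for i
    using b that unfolding ix_def bij_betw_def by (simp add: the_inv_into_f_f)
  have ixC: "ix v < ?k" "xs ! ix v = v" if "v \<in> C" for v
    using that xs ix by (auto simp: in_set_conv_nth)
  define q where "q v = xs ! (Suc (ix v) mod ?k)" for v
  have k0: "?k > 0" using xs by auto
  have qC: "q v \<in> C" for v using xs k0 by (simp add: q_def)
  have ixq: "ix (q v) = Suc (ix v) mod ?k" for v using k0 by (simp add: q_def ix)
  have qinj: "inj_on q C"
  proof (rule inj_onI)
    fix u v assume uv: "u \<in> C" "v \<in> C" "q u = q v"
    have "Suc (ix u) mod ?k = Suc (ix v) mod ?k" using uv ixq by metis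
    then have "ix u = ix v" using ixC(1)[OF uv(1)] ixC(1)[OF uv(2)]
      by (simp add: mod_Suc split: if_splits)
    then show "u = v" using ixC uv by metis
  qed
  have finC: "finite C" using xs by simp
  have qim: "q ` C = C" using qinj qC finC by (metis endo_inj_surj image_subsetI)
  have q1: "q v \<noteq> v" if "v \<in> C" for v
  proof
    assume "q v = v"
    then have "ix v = Suc (ix v) mod ?k" using ixq[of v] by simp
    moreover have "Suc i mod ?k \<noteq> i" if "i < ?k" for i
      using that xs(2) by (simp add: mod_Suc)
    ultimately show False using ixC(1)[OF that] by metis
  qed
  \<comment> \<open>Returning after two steps would need length at most 2. Since
    \<open>q (p v) = v\<close>, this will separate \<open>p v\<close> from
    \<open>q v\<close>.\<close>
  have q2: "q (q v) \<noteq> v" if "v \<in> C" for v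
  proof
    assume "q (q v) = v"
    then have "ix v = Suc (Suc (ix v) mod ?k) mod ?k" using ixq[of v] ixq[of "q v"] by simp
    moreover have "Suc (Suc i mod ?k) mod ?k \<noteq> i" if "i < ?k" for i
      using that xs(2) by (auto simp: mod_Suc)
    ultimately show False using ixC(1)[OF that] by metis
  qed
  define p where "p = inv_into C q"
  have pinj: "inj_on p C" unfolding p_def using qim inj_on_inv_into by (metis order_refl)
  have pim: "p ` C = C" unfolding p_def using qinj qim by (metis inv_into_image_cancel order_refl)
  have qp: "q (p v) = v" if "v \<in> C" for v unfolding p_def using that qim by (simp add: f_inv_into_f)
  have Fq: "F = (\<lambda>v. {q v, v}) ` C"
  proof -
    have "F = (\<lambda>i. {q (xs ! i), xs ! i}) ` {..<?k}"
      unfolding xs(4) using ix by (auto simp: q_def insert_commute image_def)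
    also have "\<dots> = (\<lambda>v. {q v, v}) ` ((!) xs ` {..<?k})" by (simp add: image_image)
    also have "(!) xs ` {..<?k} = C" using b by (simp add: bij_betw_def)
    finally show ?thesis .
  qed
  have Fp: "F = (\<lambda>v. {p v, v}) ` C"
  proof -
    have "F = (\<lambda>v. {q v, v}) ` (p ` C)" using Fq pim by simp
    also have "\<dots> = (\<lambda>v. {v, p v}) ` C" using qp by (simp add: image_image)
    finally show ?thesis by (simp add: insert_commute)
  qed
  have "p v \<noteq> v \<and> q v \<noteq> v \<and> p v \<noteq> q v" if "v \<in> C" for v
    using qp[OF that] q1[OF that] q2[OF that] by metis
  then show thesis using that[OF pinj qinj pim qim Fp Fq] by blast
qed

text \<open>Of the two neighbours \<open>p\<close>, \<open>q\<close> of \<open>y\<close>, the one returned as \<open>z\<close> becomes its predecessor, which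
  fixes the direction of the cycle. If \<open>z\<close> is \<open>a\<close> or \<open>b\<close>, then \<open>y\<close> may be any inner point on the
  corresponding side of \<open>h\<close>; otherwise two inner points on the same side of \<open>h\<close> are needed, and
  they are missing only if \<open>C\<close> has four vertices, one neighbour then being \<open>a\<close> or \<open>b\<close>.\<close>

lemma place_cycle:
  fixes Y :: "'p \<Rightarrow> real"
  assumes fin: "finite C" "finite K" and card: "card C = card K"
    and inj: "inj_on Y K" and h: "h \<notin> Y ` K"
    and ver: "y \<in> C" "a \<in> C" "b \<in> C" "y \<noteq> a" "y \<noteq> b" "a \<noteq> b"
    and nb: "p \<in> C" "q \<in> C" "p \<noteq> y" "q \<noteq> y" "p \<noteq> q"
  obtains f z where "z = p \<or> z = q" "bij_betw f C K"
    "\<And>v. v \<in> C - {a} \<Longrightarrow> Y (f a) < Y (f v)" "\<And>v. v \<in> C - {b} \<Longrightarrow> Y (f v) < Y (f b)"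
    "(Y (f z) - Y (f y)) * (h - Y (f y)) < 0"
proof -
  have "card {y, a, b} \<le> card C" using ver fin by (intro card_mono) auto
  then have c3: "card C \<ge> 3" using ver by simp
  obtain L where L: "L \<subseteq> K" "card L = 1" "\<And>q p. q \<in> L \<Longrightarrow> p \<in> K - L \<Longrightarrow> Y q < Y p"
    using obtain_lowest[OF fin(2) inj, of 1] c3 card by auto
  have "inj_on (\<lambda>x. - Y x) K" using inj by (auto simp: inj_on_def)
  then obtain U where U: "U \<subseteq> K" "card U = 1" "\<And>q p. q \<in> U \<Longrightarrow> p \<in> K - U \<Longrightarrow> - Y q < - Y p"
    using obtain_lowest[OF fin(2), of "\<lambda>x. - Y x" 1] c3 card by auto
  obtain k0 k1 where k: "L = {k0}" "U = {k1}" using L U by (auto simp: card_1_singleton_iff)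
  have lo: "Y k0 < Y x" if "x \<in> K - {k0}" for x using L k that by auto
  have hi: "Y x < Y k1" if "x \<in> K - {k1}" for x using U k that by fastforce
  have kK: "k0 \<in> K" "k1 \<in> K" using L U k by auto
  have k01: "k0 \<noteq> k1"
  proof
    assume "k0 = k1"
    then have "K - {k0} = {}" using lo hi by force
    then have "card K \<le> card {k0}" by (intro card_mono) auto
    then show False using c3 card by simp
  qed
  define M where "M = K - {k0, k1}"
  have cardM: "card M = card C - 2" using kK k01 card fin by (simp add: M_def card_Diff_subset)
  have MK: "M \<subseteq> K" "k0 \<notin> M" "k1 \<notin> M" by (auto simp: M_def)
  have YM: "Y k0 < Y m" "Y m < Y k1" if "m \<in> M" for m using lo hi that by (auto simp: M_def)
  \<comment> \<open>Saved under a new name because \<open>that\<close> is rebound in the nested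
    claims below.\<close>
  note goal = that
  \<comment> \<open>Only \<open>y\<close>, its predecessor \<open>z\<close>, \<open>a\<close> and
    \<open>b\<close> need prescribed points: once \<open>a\<close> and \<open>b\<close> sit on the
    extreme points \<open>k0\<close> and \<open>k1\<close>, the others may be placed
    arbitrarily.\<close>
  have draw: thesis
    if g: "inj_on g {y, z, a, b}" "g ` {y, z, a, b} \<subseteq> K" "g a = k0" "g b = k1"
      and z: "z = p \<or> z = q" and gy: "(Y (g z) - Y (g y)) * (h - Y (g y)) < 0" for g z
  proof -
    obtain f where f: "bij_betw f C K" "\<And>d. d \<in> {y, z, a, b} \<Longrightarrow> f d = g d"
      using bij_betw_extend_partial[OF fin card _ g(1,2)] ver nb z by auto
    have im: "f v \<in> K" if "v \<in> C" for v using f that by (auto simp: bij_betw_def)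
    have ne: "f u \<noteq> f v" if "u \<in> C" "v \<in> C" "u \<noteq> v" for u v
      using f that by (auto simp: bij_betw_def dest: inj_onD)
    have fab: "f a = k0" "f b = k1" using f(2) g by auto
    show thesis
    proof (rule goal[OF z f(1)])
      show "Y (f a) < Y (f v)" if "v \<in> C - {a}" for v
        using lo[of "f v"] im[of v] ne[of a v] ver that fab by auto
      show "Y (f v) < Y (f b)" if "v \<in> C - {b}" for v
        using hi[of "f v"] im[of v] ne[of b v] ver that fab by auto
      show "(Y (f z) - Y (f y)) * (h - Y (f y)) < 0" using gy f(2) by simp
    qed
  qed
  \<comment> \<open>Here \<open>z\<close> is \<open>b\<close>, at the top; the default value
    \<open>m\<close> is the point of \<open>y\<close>, which lies between \<open>h\<close> and
    \<open>k1\<close>. The next claim is the mirror image with \<open>a\<close> at the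
    bottom.\<close>
  have high: thesis if "m \<in> M" "h < Y m" "p = b \<or> q = b" for m
    by (rule draw[of "(\<lambda>_. m)(a := k0, b := k1)" b])
       (use that ver nb MK kK k01 YM[of m] in \<open>auto simp: inj_on_def mult_less_0_iff\<close>)
  have low: thesis if "m \<in> M" "Y m < h" "p = a \<or> q = a" for m
    by (rule draw[of "(\<lambda>_. m)(a := k0, b := k1)" a])
       (use that ver nb MK kK k01 YM[of m] in \<open>auto simp: inj_on_def mult_less_0_iff\<close>)
  \<comment> \<open>Now \<open>y\<close> is put on \<open>m\<close> and its predecessor
    \<open>w\<close> on the default value \<open>m'\<close>; the product condition says that
    \<open>m\<close> lies between \<open>m'\<close> and \<open>h\<close>.\<close>
  have mid: thesis if "m \<in> M" "m' \<in> M" "(Y m' - Y m) * (h - Y m) < 0" "w = p \<or> w = q" "w \<noteq> a" "w \<noteq> b"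
    for m m' w
  proof -
    have "m \<noteq> m'" using that(3) by auto
    then show thesis
      by (intro draw[of "(\<lambda>_. m')(a := k0, b := k1, y := m)" w])
         (use that ver nb MK kK k01 in \<open>auto simp: inj_on_def\<close>)
  qed
  have side: "Y m < h \<or> h < Y m" if "m \<in> M" for m
    using h MK that by (metis image_eqI linorder_neqE_linordered_idom subsetD)
  show thesis
  proof (cases "{p, q} \<subseteq> {a, b}")
    case True
    then have "{p, q} = {a, b}" using nb by auto
    moreover have "M \<noteq> {}" using cardM c3 by auto
    then obtain m where "m \<in> M" by blast
    ultimately show thesis using high[of m] low[of m] side[of m] by (auto simp: doubleton_eq_iff)
  next
    case False
    then obtain w where w: "w = p \<or> w = q" "w \<noteq> a" "w \<noteq> b" by auto
    have wC: "w \<in> C" "w \<noteq> y" using w nb by auto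
    show thesis
    proof (cases "\<exists>m\<in>M. \<exists>m'\<in>M. m \<noteq> m' \<and> (Y m < h \<longleftrightarrow> Y m' < h)")
      case True
      then obtain m m' where m: "m \<in> M" "m' \<in> M" "m \<noteq> m'" "Y m < h \<longleftrightarrow> Y m' < h" by blast
      have "Y m \<noteq> Y m'" using m inj MK by (auto dest: inj_onD)
      \<comment> \<open>Of two points on the same side of \<open>h\<close>, the one nearer to
        \<open>h\<close> lies between the other one and \<open>h\<close>.\<close>
      then have "(Y m' - Y m) * (h - Y m) < 0 \<or> (Y m - Y m') * (h - Y m') < 0"
        using side[OF m(1)] side[OF m(2)] m(4) by (auto simp: mult_less_0_iff)
      then show thesis using mid m w by blast
    next
      case False
      have "{y, w, a, b} \<subseteq> C" "card {y, w, a, b} = 4" using ver wC w by auto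
      then have c4: "card C \<ge> 4" using fin by (metis card_mono)
      \<comment> \<open>Each side of \<open>h\<close> holds at most one inner point, so
        \<open>M\<close> embeds into \<open>bool\<close>. With four vertices present, both sides
        turn out to be occupied, and \<open>high\<close> or \<open>low\<close> applies.\<close>
      have inj': "inj_on (\<lambda>m. Y m < h) M" using False by (auto simp: inj_on_def)
      have "card M = card ((\<lambda>m. Y m < h) ` M)" using inj' by (simp add: card_image)
      also have "\<dots> \<le> card (UNIV :: bool set)" by (intro card_mono) auto
      finally have "card M \<le> 2" by simp
      then have cC: "card C = 4" and cM: "card M = 2" using c4 cardM by auto
      have CC: "C = {y, w, a, b}"
        using \<open>{y, w, a, b} \<subseteq> C\<close> \<open>card {y, w, a, b} = 4\<close> cC fin by (metis card_subset_eq)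
      have "card ((\<lambda>m. Y m < h) ` M) = card (UNIV :: bool set)" using inj' cM by (simp add: card_image)
      then have "(\<lambda>m. Y m < h) ` M = UNIV" by (intro card_subset_eq) auto
      then obtain m m' where "m \<in> M" "Y m < h" "m' \<in> M" "\<not> Y m' < h"
        by (metis (mono_tags, lifting) UNIV_I imageE)
      moreover have "p = a \<or> p = b \<or> q = a \<or> q = b" using CC nb w by auto
      ultimately show thesis using high[of m'] low[of m] side[of m'] by blast
    qed
  qed
qed

section \<open>Port assignments: drawing a branch and attaching branches to a cycle\<close>

text \<open>A pair \<open>(u, v)\<close> of \<open>R\<close> stands for an edge that leaves \<open>u\<close> in \<open>X\<close>-direction and \<open>v\<close> in
  \<open>Y\<close>-direction. The coordinate functions are parameters so that they can be exchanged, which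
  amounts to passing to the converse of \<open>R\<close>.\<close>

definition separated_ports ::
    "(point \<Rightarrow> real) \<Rightarrow> (point \<Rightarrow> real) \<Rightarrow> ('a \<Rightarrow> point) \<Rightarrow> ('a \<times> 'a) set \<Rightarrow> bool" where
  "separated_ports X Y \<mu> R \<longleftrightarrow>
     (\<forall>u v w. (u, v) \<in> R \<and> (u, w) \<in> R \<and> v \<noteq> w \<longrightarrow>
        (X (\<mu> v) - X (\<mu> u)) * (X (\<mu> w) - X (\<mu> u)) < 0) \<and>
     (\<forall>u v w. (v, u) \<in> R \<and> (w, u) \<in> R \<and> v \<noteq> w \<longrightarrow>
        (Y (\<mu> v) - Y (\<mu> u)) * (Y (\<mu> w) - Y (\<mu> u)) < 0)"

text \<open>The last condition says that the port of \<open>y\<close> in \<open>Y\<close>-direction towards level \<open>h\<close> is free.\<close>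

definition hangable :: "'a set \<Rightarrow> 'a set set \<Rightarrow> 'a \<Rightarrow> bool" where
  "hangable V E y \<longleftrightarrow>
     (\<forall>P X Y h. finite P \<and> card P = card V \<and> inj_on X P \<and> inj_on Y P \<and> h \<notin> Y ` P \<longrightarrow>
        (\<exists>\<mu> R. bij_betw \<mu> V P \<and> R \<subseteq> V \<times> V \<and> E = (\<lambda>(u, v). {u, v}) ` R \<and>
           separated_ports X Y \<mu> R \<and>
           (\<forall>v. (v, y) \<in> R \<longrightarrow> (Y (\<mu> v) - Y (\<mu> y)) * (h - Y (\<mu> y)) < 0)))"

text \<open>A missing subtree counts as an empty branch, so that every cycle carries exactly two.\<close>

definition branch :: "'a \<Rightarrow> 'a set \<Rightarrow> 'a set set \<Rightarrow> bool" where
  "branch a V E \<longleftrightarrow> V = {} \<and> E = {} \<or> (\<exists>y E'. y \<in> V \<and> hangable V E' y \<and> E = insert {y, a} E')"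

lemma separated_ports_cong:
  assumes "R \<subseteq> V \<times> V" "\<And>v. v \<in> V \<Longrightarrow> \<mu> v = \<nu> v"
  shows "separated_ports X Y \<mu> R \<longleftrightarrow> separated_ports X Y \<nu> R"
proof -
  have "\<mu> u = \<nu> u" "\<mu> v = \<nu> v" if "(u, v) \<in> R" for u v using assms that by auto
  then show ?thesis unfolding separated_ports_def by (smt (verit))
qed

text \<open>Hang the subtree with the coordinates exchanged and take the converse of its relation.
  The level to hang from is \<open>X c\<close>, so the port of \<open>y\<close> in
  \<open>X\<close>-direction towards \<open>c\<close> is free for the link \<open>(y, a)\<close>,
  which reaches \<open>a\<close> in \<open>Y\<close>-direction.\<close>

lemma branch_draw:
  assumes br: "branch a V E" "a \<notin> V" and P: "finite P" "card P = card V" "c \<notin> P"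
    and inj: "inj_on X (insert c P)" "inj_on Y P"
  obtains \<mu> R where "bij_betw \<mu> V P" "R \<subseteq> V \<times> insert a V" "E = (\<lambda>(u, v). {u, v}) ` R"
    "separated_ports X Y (\<mu>(a := c)) R"
  using br(1) unfolding branch_def
proof (elim disjE conjE exE)
  assume "V = {}" "E = {}"
  then show thesis using P by (intro that[of undefined "{}"]) (auto simp: separated_ports_def bij_betw_def)
next
  fix y E' assume y: "y \<in> V" "hangable V E' y" "E = insert {y, a} E'"
  have "X c \<notin> X ` P" using inj P by auto
  then obtain \<mu> R where m: "bij_betw \<mu> V P" "R \<subseteq> V \<times> V" "E' = (\<lambda>(u, v). {u, v}) ` R"
    "separated_ports Y X \<mu> R" "\<forall>v. (v, y) \<in> R \<longrightarrow> (X (\<mu> v) - X (\<mu> y)) * (X c - X (\<mu> y)) < 0"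
    using y(2)[unfolded hangable_def, rule_format, of P Y X "X c"] P inj by auto
  have sep: "separated_ports Y X (\<mu>(a := c)) R"
    using m(4) br(2) by (subst separated_ports_cong[OF m(2), of _ \<mu>]) auto
  have ya: "y \<noteq> a" using y br by auto
  have na: "(u, a) \<notin> R" "(a, u) \<notin> R" for u using m(2) br(2) by auto
  show thesis
  proof (rule that[of \<mu> "insert (y, a) (R\<inverse>)"])
    show "bij_betw \<mu> V P" by fact
    show "insert (y, a) (R\<inverse>) \<subseteq> V \<times> insert a V" using y m by auto
    have "(\<lambda>(u, v). {u, v}) ` (R\<inverse>) = (\<lambda>(u, v). {u, v}) ` R"
      by (force simp: image_iff insert_commute)
    then show "E = (\<lambda>(u, v). {u, v}) ` insert (y, a) (R\<inverse>)" using y m by simp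
    show "separated_ports X Y (\<mu>(a := c)) (insert (y, a) (R\<inverse>))"
      unfolding separated_ports_def
    proof (intro conjI allI impI; elim conjE)
      fix u v w assume *: "(u, v) \<in> insert (y, a) (R\<inverse>)" "(u, w) \<in> insert (y, a) (R\<inverse>)" "v \<noteq> w"
      \<comment> \<open>The link can compete only with an old edge at \<open>y\<close>, and the free
        port guaranteed by \<open>hangable\<close> settles that case.\<close>
      consider "(v, u) \<in> R" "(w, u) \<in> R" | "u = y" "v = a" "(w, y) \<in> R" | "u = y" "w = a" "(v, y) \<in> R"
        using * by auto
      then show "(X ((\<mu>(a := c)) v) - X ((\<mu>(a := c)) u)) * (X ((\<mu>(a := c)) w) - X ((\<mu>(a := c)) u)) < 0"
      proof cases
        case 1
        then show ?thesis using sep *(3) unfolding separated_ports_def by blast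
      next
        case 2
        then have "w \<noteq> a" using na by auto
        then show ?thesis using 2 m(5) ya by (simp add: mult.commute)
      next
        case 3
        then have "v \<noteq> a" using na by auto
        then show ?thesis using 3 m(5) ya by (simp add: mult.commute)
      qed
    next
      fix u v w assume *: "(v, u) \<in> insert (y, a) (R\<inverse>)" "(w, u) \<in> insert (y, a) (R\<inverse>)" "v \<noteq> w"
      \<comment> \<open>The link is the only pair ending at \<open>a\<close>, so two different pairs
        with a common end are both old.\<close>
      then have "(u, v) \<in> R" "(u, w) \<in> R" using na by auto
      then show "(Y ((\<mu>(a := c)) v) - Y ((\<mu>(a := c)) u)) * (Y ((\<mu>(a := c)) w) - Y ((\<mu>(a := c)) u)) < 0"
        using sep *(3) unfolding separated_ports_def by blast
    qed
  qed
qed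

text \<open>Each part has separated ports by itself, and the parts interact only at \<open>a\<close>
  and \<open>b\<close>: there the cycle predecessor and the branch arrive in
  \<open>Y\<close>-direction from opposite sides, because the branches get the extreme points and
  \<open>a\<close> and \<open>b\<close> are extreme on the cycle.\<close>

lemma hangable_cycle:
  assumes cyc: "is_cycle C F" and ver: "y \<in> C" "a \<in> C" "b \<in> C" "y \<noteq> a" "y \<noteq> b" "a \<noteq> b"
    and br: "branch a VA EA" "branch b VB EB" and fin: "finite VA" "finite VB"
    and disj: "C \<inter> VA = {}" "C \<inter> VB = {}" "VA \<inter> VB = {}"
  shows "hangable (C \<union> VA \<union> VB) (F \<union> EA \<union> EB) y"
  unfolding hangable_def
proof (intro allI impI; elim conjE)
  fix P :: "point set" and X Y :: "point \<Rightarrow> real" and h :: real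
  assume P: "finite P" "card P = card (C \<union> VA \<union> VB)" and inj: "inj_on X P" "inj_on Y P"
    and h: "h \<notin> Y ` P"
  obtain p q where pq: "inj_on p C" "inj_on q C" "p ` C = C" "q ` C = C"
    "F = (\<lambda>v. {p v, v}) ` C" "F = (\<lambda>v. {q v, v}) ` C"
    "\<And>v. v \<in> C \<Longrightarrow> p v \<noteq> v \<and> q v \<noteq> v \<and> p v \<noteq> q v"
    by (rule cycle_predecessors[OF cyc]) (rule that)
  have cardP: "card P = card C + card VA + card VB"
  proof -
    have "(C \<union> VA) \<inter> VB = {}" using disj by auto
    then show ?thesis using P(2) is_cycle_card(1)[OF cyc] fin disj by (simp add: card_Un_disjoint)
  qed
  obtain PA where PA: "PA \<subseteq> P" "card PA = card VA"
    "\<And>q p. q \<in> PA \<Longrightarrow> p \<in> P - PA \<Longrightarrow> Y q < Y p"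
    using obtain_lowest[OF P(1) inj(2), of "card VA"] cardP by auto
  have fA: "finite PA" using PA P finite_subset by auto
  have "inj_on (\<lambda>x. - Y x) (P - PA)" using inj by (auto simp: inj_on_def)
  then obtain PB where PB: "PB \<subseteq> P - PA" "card PB = card VB"
    "\<And>q p. q \<in> PB \<Longrightarrow> p \<in> P - PA - PB \<Longrightarrow> - Y q < - Y p"
    using obtain_lowest[of "P - PA" "\<lambda>x. - Y x" "card VB"] cardP PA fA P(1)
    by (auto simp: card_Diff_subset)
  define K where "K = P - PA - PB"
  have fB: "finite PB" using PB P finite_subset by (metis finite_Diff)
  have K: "finite K" "card C = card K" "K \<subseteq> P" "K \<inter> PA = {}" "K \<inter> PB = {}" "PA \<inter> PB = {}" "PA \<union> PB \<union> K = P"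
    using P cardP PA PB fA fB by (auto simp: K_def card_Diff_subset)
  have py: "p y \<in> C" "q y \<in> C" "p y \<noteq> y" "q y \<noteq> y" "p y \<noteq> q y" using pq ver by auto
  have YK: "inj_on Y K" "h \<notin> Y ` K" using inj h K by (auto intro: inj_on_subset)
  obtain f z where fz: "z = p y \<or> z = q y" "bij_betw f C K"
    "\<And>v. v \<in> C - {a} \<Longrightarrow> Y (f a) < Y (f v)" "\<And>v. v \<in> C - {b} \<Longrightarrow> Y (f v) < Y (f b)"
    "(Y (f z) - Y (f y)) * (h - Y (f y)) < 0"
    by (rule place_cycle[OF is_cycle_card(1)[OF cyc] K(1,2) YK ver py]) (rule that)
  \<comment> \<open>Fix the orientation in which the neighbour selected by
    \<open>place_cycle\<close> precedes \<open>y\<close>.\<close>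
  obtain s where s: "inj_on s C" "s ` C = C" "F = (\<lambda>v. {s v, v}) ` C" "\<And>v. v \<in> C \<Longrightarrow> s v \<noteq> v" "s y = z"
    using fz(1)
    by (elim disjE) (rule that[of p] that[of q]; use pq in simp)+
  have fK: "f v \<in> K" if "v \<in> C" for v using fz(2) that by (auto simp: bij_betw_def)
  have below: "Y c < Y (f v)" if "c \<in> PA" "v \<in> C" for c v using PA(3) that fK[of v] by (auto simp: K_def)
  have above: "Y (f v) < Y c" if "c \<in> PB" "v \<in> C" for c v using PB(3)[of c "f v"] that fK[of v] by (auto simp: K_def)
  have anA: "a \<notin> VA" "b \<notin> VB" using disj ver by auto
  have fa: "f a \<notin> PA" "f b \<notin> PB" using fK ver K by auto
  have injs: "inj_on X (insert (f a) PA)" "inj_on Y PA" "inj_on X (insert (f b) PB)" "inj_on Y PB"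
    by (rule inj_on_subset[OF inj(1)] inj_on_subset[OF inj(2)],
        use PA(1) PB(1) fK[OF ver(2)] fK[OF ver(3)] K(3) in blast)+
  obtain \<mu>A RA where A: "bij_betw \<mu>A VA PA" "RA \<subseteq> VA \<times> insert a VA" "EA = (\<lambda>(u, v). {u, v}) ` RA"
    "separated_ports X Y (\<mu>A(a := f a)) RA"
    by (rule branch_draw[OF br(1) anA(1) fA PA(2) fa(1) injs(1,2)]) (rule that)
  obtain \<mu>B RB where B: "bij_betw \<mu>B VB PB" "RB \<subseteq> VB \<times> insert b VB" "EB = (\<lambda>(u, v). {u, v}) ` RB"
    "separated_ports X Y (\<mu>B(b := f b)) RB"
    by (rule branch_draw[OF br(2) anA(2) fB PB(2) fa(2) injs(3,4)]) (rule that)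
  define \<mu> where "\<mu> v = (if v \<in> VA then \<mu>A v else if v \<in> VB then \<mu>B v else f v)" for v
  define RC where "RC = (\<lambda>v. (s v, v)) ` C"
  define R where "R = RC \<union> RA \<union> RB"
  have mC: "\<mu> v = f v" if "v \<in> C" for v using that disj by (auto simp: \<mu>_def)
  have mA: "\<mu> v = \<mu>A v" if "v \<in> VA" for v using that by (auto simp: \<mu>_def)
  have mB: "\<mu> v = \<mu>B v" if "v \<in> VB" for v using that disj by (auto simp: \<mu>_def)
  have RC: "RC \<subseteq> C \<times> C" using s by (auto simp: RC_def)
  have sepA: "separated_ports X Y \<mu> RA"
  proof -
    have "RA \<subseteq> insert a VA \<times> insert a VA" using A(2) by auto
    note cong = separated_ports_cong[OF this]
    show ?thesis
      by (subst cong[of _ "\<mu>A(a := f a)"]) (use A(4) mC ver mA in auto)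
  qed
  have sepB: "separated_ports X Y \<mu> RB"
  proof -
    have "RB \<subseteq> insert b VB \<times> insert b VB" using B(2) by auto
    note cong = separated_ports_cong[OF this]
    show ?thesis
      by (subst cong[of _ "\<mu>B(b := f b)"]) (use B(4) mC ver mB in auto)
  qed
  have bij: "bij_betw \<mu> (C \<union> VA \<union> VB) P"
  proof -
    have "bij_betw \<mu> C K" using fz(2) mC by (simp cong: bij_betw_cong)
    moreover have "bij_betw \<mu> VA PA" using A(1) mA by (simp cong: bij_betw_cong)
    moreover have "bij_betw \<mu> VB PB" using B(1) mB by (simp cong: bij_betw_cong)
    ultimately have "bij_betw \<mu> (C \<union> VA \<union> VB) (K \<union> PA \<union> PB)"
      using K by (intro bij_betw_combine) auto
    moreover have "K \<union> PA \<union> PB = P" using K by auto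
    ultimately show ?thesis by simp
  qed
  have YA: "Y (\<mu> v) < Y (\<mu> a)" if "v \<in> VA" for v
    using below[of "\<mu>A v" a] that A(1) ver mA mC by (auto simp: bij_betw_def)
  have YB: "Y (\<mu> b) < Y (\<mu> v)" if "v \<in> VB" for v
    using above[of "\<mu>B v" b] that B(1) ver mB mC by (auto simp: bij_betw_def)
  have sC: "s v \<in> C" if "v \<in> C" for v using s(2) that by blast
  have sa: "Y (\<mu> a) < Y (\<mu> (s a))" "Y (\<mu> (s b)) < Y (\<mu> b)"
    using fz(3)[of "s a"] fz(4)[of "s b"] s(4) sC ver mC by auto
  have "separated_ports X Y \<mu> R"
    unfolding separated_ports_def
  proof (intro conjI allI impI; elim conjE)
    fix u v w assume *: "(u, v) \<in> R" "(u, w) \<in> R" "v \<noteq> w"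
    \<comment> \<open>First components lie in the disjoint sets \<open>VA\<close>, \<open>VB\<close>
      and \<open>C\<close>, since links start in the branches; hence no mixed case arises in
      \<open>X\<close>-direction.\<close>
    consider "(u, v) \<in> RA" "(u, w) \<in> RA" | "(u, v) \<in> RB" "(u, w) \<in> RB" | "(u, v) \<in> RC" "(u, w) \<in> RC"
      using * A(2) B(2) RC disj unfolding R_def by blast
    then show "(X (\<mu> v) - X (\<mu> u)) * (X (\<mu> w) - X (\<mu> u)) < 0"
    proof cases
      case 3
      then show ?thesis using s(1) *(3) by (auto simp: RC_def dest: inj_onD)
    qed (use sepA sepB *(3) in \<open>auto simp: separated_ports_def\<close>)
  next
    have mixed: "(Y (\<mu> v) - Y (\<mu> u)) * (Y (\<mu> w) - Y (\<mu> u)) < 0"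
      if "(v, u) \<in> RC" "(w, u) \<in> RA \<union> RB" for u v w
    proof -
      have u: "u \<in> C" "v = s u" using that s by (auto simp: RC_def)
      from that(2) consider "u = a" "w \<in> VA" | "u = b" "w \<in> VB" using u A(2) B(2) disj by auto
      then show ?thesis
        using u sa YA[of w] YB[of w] by cases (auto simp: mult_less_0_iff)
    qed
    fix u v w assume *: "(v, u) \<in> R" "(w, u) \<in> R" "v \<noteq> w"
    consider "(v, u) \<in> RA" "(w, u) \<in> RA" | "(v, u) \<in> RB" "(w, u) \<in> RB" | "(v, u) \<in> RC" "(w, u) \<in> RC"
      | "(v, u) \<in> RC" "(w, u) \<in> RA \<union> RB" | "(w, u) \<in> RC" "(v, u) \<in> RA \<union> RB"
      using * A(2) B(2) disj ver unfolding R_def by blast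
    then show "(Y (\<mu> v) - Y (\<mu> u)) * (Y (\<mu> w) - Y (\<mu> u)) < 0"
    proof cases
      case 3
      then show ?thesis using *(3) by (auto simp: RC_def)
    next
      case 4
      then show ?thesis using mixed by blast
    next
      case 5
      then show ?thesis using mixed[of w u v] by (simp add: mult.commute)
    qed (use sepA sepB *(3) in \<open>auto simp: separated_ports_def\<close>)
  qed
  moreover have "F \<union> EA \<union> EB = (\<lambda>(u, v). {u, v}) ` R"
    unfolding R_def image_Un A(3) B(3) RC_def s(3) by (simp add: image_image)
  moreover have "R \<subseteq> (C \<union> VA \<union> VB) \<times> (C \<union> VA \<union> VB)" unfolding R_def using RC A(2) B(2) ver by auto
  moreover have "(Y (\<mu> v) - Y (\<mu> y)) * (h - Y (\<mu> y)) < 0" if "(v, y) \<in> R" for v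
  proof -
    \<comment> \<open>As \<open>y\<close> differs from \<open>a\<close> and \<open>b\<close>, no
      link ends there.\<close>
    have "(v, y) \<in> RC" using that A(2) B(2) ver disj unfolding R_def by blast
    then have "v = z" "z \<in> C" using s ver by (auto simp: RC_def)
    then show ?thesis using fz(5) mC ver by simp
  qed
  ultimately show "\<exists>\<mu> R. bij_betw \<mu> (C \<union> VA \<union> VB) P \<and> R \<subseteq> (C \<union> VA \<union> VB) \<times> (C \<union> VA \<union> VB) \<and>
      F \<union> EA \<union> EB = (\<lambda>(u, v). {u, v}) ` R \<and> separated_ports X Y \<mu> R \<and>
      (\<forall>v. (v, y) \<in> R \<longrightarrow> (Y (\<mu> v) - Y (\<mu> y)) * (h - Y (\<mu> y)) < 0)"
    using bij by blast
qed

section \<open>Binary trees and the induction over them\<close>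

lemma binary_tree_unique_parent:
  assumes "binary_tree N r A" "(s, t) \<in> A" "(s', t) \<in> A"
  shows "s = s'"
proof -
  have "t \<in> N - {r}" using assms unfolding binary_tree_def by auto
  then show ?thesis using assms unfolding binary_tree_def by blast
qed

text \<open>A directed cycle through \<open>t\<close> passes through the unique parent of
  \<open>t\<close>. Going up in this way it would reach the root, which has no parent.\<close>

lemma binary_tree_acyclic:
  assumes tree: "binary_tree N r A"
  shows "acyclic A"
proof -
  have "(t, t) \<notin> A\<^sup>+" if "(r, t) \<in> A\<^sup>*" for t
    using that
  proof (induction rule: rtrancl_induct)
    case base
    show ?case using tree unfolding binary_tree_def by (meson tranclD2)
  next
    case (step s t)
    show ?case
    proof
      assume "(t, t) \<in> A\<^sup>+"
      then obtain p where p: "(t, p) \<in> A\<^sup>*" "(p, t) \<in> A" by (meson tranclD2)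
      have "p = s" using binary_tree_unique_parent[OF tree p(2) step(2)] .
      then show False using p step rtrancl_into_trancl2 by metis
    qed
  qed
  moreover have "(r, t) \<in> A\<^sup>*" if "(t, t) \<in> A\<^sup>+" for t
  proof -
    have "t \<in> N" using that tree unfolding binary_tree_def by (meson SigmaD1 subsetD tranclD)
    then show ?thesis using tree unfolding binary_tree_def by blast
  qed
  ultimately show ?thesis unfolding acyclic_def by blast
qed

text \<open>The ancestors of a vertex form a chain, so a common descendant makes the siblings
  comparable. A path from one to the other enters the latter through the parent \<open>t\<close> and
  closes a cycle at \<open>t\<close>.\<close>

lemma binary_tree_siblings_disjoint:
  assumes tree: "binary_tree N r A" and A: "(t, u) \<in> A" "(t, w) \<in> A" "u \<noteq> w"
  shows "A\<^sup>* `` {u} \<inter> A\<^sup>* `` {w} = {}"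
proof -
  have no: False if "(u, w) \<in> A\<^sup>*" "(t, u) \<in> A" "(t, w) \<in> A" "u \<noteq> w" for u w
  proof -
    from that obtain p where p: "(u, p) \<in> A\<^sup>*" "(p, w) \<in> A" by (meson rtranclE)
    then have "p = t" using binary_tree_unique_parent[OF tree] that by metis
    then have "(t, t) \<in> A\<^sup>+" using p that rtrancl_into_trancl2 by metis
    then show False using binary_tree_acyclic[OF tree] unfolding acyclic_def by blast
  qed
  have sv: "single_valued (A\<inverse>)"
    using binary_tree_unique_parent[OF tree] by (auto simp: single_valued_def)
  have "(u, w) \<in> A\<^sup>* \<or> (w, u) \<in> A\<^sup>*" if "(u, s) \<in> A\<^sup>*" "(w, s) \<in> A\<^sup>*" for s
    using single_valued_confluent[OF sv, of s u w] that by (auto simp: rtrancl_converse)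
  then show ?thesis using no[of u w] no[of w u] A by blast
qed

lemma UN_descendants:
  "(\<Union>s\<in>A\<^sup>* `` {t}. G s) = G t \<union> (\<Union>u\<in>A `` {t}. \<Union>s\<in>A\<^sup>* `` {u}. G s)"
proof -
  have "A\<^sup>* `` {t} = insert t (\<Union>u\<in>A `` {t}. A\<^sup>* `` {u})"
    by (auto intro: converse_rtrancl_into_rtrancl elim: converse_rtranclE)
  then show ?thesis by auto
qed

text \<open>Supplies attachment vertices for the empty branches that replace missing
  subtrees.\<close>

lemma obtain_other:
  assumes "card C \<ge> 3"
  obtains c where "c \<in> C" "c \<noteq> a" "c \<noteq> b"
proof -
  have "\<not> C \<subseteq> {a, b}"
  proof
    assume "C \<subseteq> {a, b}"
    then have "card C \<le> card {a, b}" by (intro card_mono) auto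
    also have "\<dots> \<le> 2" by (simp add: card_insert_if)
    finally show False using assms by simp
  qed
  then show thesis using that by auto
qed

text \<open>The two cycle edges at \<open>v\<close> are contained in \<open>C\<close>, hence differ
  from \<open>e\<close> and \<open>e'\<close>. Under the degree bound 3 this forbids two links at
  one vertex.\<close>

lemma vertex_degree_cycle_plus_two:
  assumes "is_cycle C F" "finite E" "F \<subseteq> E" "v \<in> C"
    and "e \<in> E" "e' \<in> E" "e \<noteq> e'" "v \<in> e" "v \<in> e'" "\<not> e \<subseteq> C" "\<not> e' \<subseteq> C"
  shows "vertex_degree E v \<ge> 4"
proof -
  obtain p q where pq: "inj_on p C" "inj_on q C" "p ` C = C" "q ` C = C"
    "F = (\<lambda>v. {p v, v}) ` C" "F = (\<lambda>v. {q v, v}) ` C"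
    "\<And>v. v \<in> C \<Longrightarrow> p v \<noteq> v \<and> q v \<noteq> v \<and> p v \<noteq> q v"
    by (rule cycle_predecessors[OF assms(1)]) (rule that)
  have ne: "{p v, v} \<noteq> {q v, v}" using pq(7)[OF assms(4)] by (auto simp: doubleton_eq_iff)
  have sub: "{p v, v} \<subseteq> C" "{q v, v} \<subseteq> C" using pq(3,4) assms(4) by auto
  have "{p v, v} \<in> F" using assms(4) unfolding pq(5) by blast
  moreover have "{q v, v} \<in> F" using assms(4) unfolding pq(6) by blast
  ultimately have "{{p v, v}, {q v, v}, e, e'} \<subseteq> {e \<in> E. v \<in> e}" using assms by auto
  moreover have "{p v, v} \<noteq> e" "{p v, v} \<noteq> e'" "{q v, v} \<noteq> e" "{q v, v} \<noteq> e'"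
    using sub assms(10,11) by metis+
  then have "card {{p v, v}, {q v, v}, e, e'} = 4" using ne assms(7) by simp
  moreover have "finite {e \<in> E. v \<in> e}" using assms(2) by simp
  ultimately show ?thesis unfolding vertex_degree_def using card_mono by metis
qed

text \<open>Induction from the leaves upwards: the subtrees of the children become the branches of
  \<open>hangable_cycle\<close>. Each link is counted with its parent, so that unfolding at
  \<open>t\<close> leaves exactly the subtrees and their links.\<close>

lemma hangable_subtree:
  fixes C :: "'t \<Rightarrow> 'a set"
  assumes tree: "binary_tree N r A" and cyc: "\<And>t. t \<in> N \<Longrightarrow> is_cycle (C t) (F t)"
    and disj: "disjoint_family_on C N"
    and link: "\<And>s t. (s, t) \<in> A \<Longrightarrow> x s t \<in> C s \<and> y s t \<in> C t"
    and m1: "\<And>t u w. (t, u) \<in> A \<Longrightarrow> (t, w) \<in> A \<Longrightarrow> u \<noteq> w \<Longrightarrow> x t u \<noteq> x t w"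
    and m2: "\<And>s t u. (s, t) \<in> A \<Longrightarrow> (t, u) \<in> A \<Longrightarrow> y s t \<noteq> x t u"
    and t: "t \<in> N" "e \<in> C t" "\<And>u. (t, u) \<in> A \<Longrightarrow> e \<noteq> x t u"
  shows "hangable (\<Union>s\<in>A\<^sup>* `` {t}. C s)
    (\<Union>s\<in>A\<^sup>* `` {t}. F s \<union> (\<lambda>u. {x s u, y s u}) ` (A `` {s})) e"
proof -
  define G where "G s = F s \<union> (\<lambda>u. {x s u, y s u}) ` (A `` {s})" for s
  define U where "U t = (\<Union>s\<in>A\<^sup>* `` {t}. C s)" for t
  define W where "W t = (\<Union>s\<in>A\<^sup>* `` {t}. G s)" for t
  have AN: "A \<subseteq> N \<times> N" and finN: "finite N" using tree by (auto simp: binary_tree_def)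
  have desc: "s \<in> N" if "t \<in> N" "(t, s) \<in> A\<^sup>*" for t s
    using that(2,1) AN by (induction rule: rtrancl_induct) auto
  have ac: "acyclic A" by (rule binary_tree_acyclic[OF tree])
  have "finite A" using AN finN finite_subset by blast
  then have wf: "wf (A\<inverse>)" using ac finite_acyclic_wf_converse by blast
  have finC: "finite (C t)" "card (C t) \<ge> 3" if "t \<in> N" for t
    using is_cycle_card[OF cyc[OF that]] by auto
  have finU: "finite (U t)" if "t \<in> N" for t
  proof -
    have "A\<^sup>* `` {t} \<subseteq> N" using desc that by auto
    then show ?thesis unfolding U_def using finC(1) finite_subset[OF _ finN] by (intro finite_UN_I) auto
  qed
  have CC: "C s \<inter> C t = {}" if "s \<in> N" "t \<in> N" "s \<noteq> t" for s t
    using disj that unfolding disjoint_family_on_def by blast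
  have CU: "C t \<inter> U u = {}" if "(t, u) \<in> A" for t u
  proof -
    have "s \<noteq> t" if "(u, s) \<in> A\<^sup>*" for s
      using that \<open>(t, u) \<in> A\<close> ac rtrancl_into_trancl2 unfolding acyclic_def by metis
    then show ?thesis unfolding U_def using CC desc that AN by blast
  qed
  have UU: "U u \<inter> U w = {}" if "(t, u) \<in> A" "(t, w) \<in> A" "u \<noteq> w" for t u w
    using binary_tree_siblings_disjoint[OF tree that] CC desc that AN unfolding U_def by blast
  have "hangable (U t) (W t) e"
    using t
  proof (induction t arbitrary: e rule: wf_induct_rule[OF wf])
    case (1 t)
    have tN: "t \<in> N" using 1 by blast
    let ?L = "\<lambda>u. insert {y t u, x t u} (W u)"
    have br: "branch (x t u) (U u) (?L u)" if u: "(t, u) \<in> A" for u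
    proof -
      \<comment> \<open>By \<open>m2\<close>, the vertex linked to the parent carries no link to a
        child, so the induction hypothesis applies to it.\<close>
      have "hangable (U u) (W u) (y t u)"
        by (rule "1.IH") (use u AN link m2 in auto)
      moreover have "y t u \<in> U u" using link[OF u] by (auto simp: U_def)
      ultimately show ?thesis unfolding branch_def by blast
    qed
    have U: "U t = C t \<union> (\<Union>u\<in>A `` {t}. U u)" unfolding U_def by (rule UN_descendants)
    have "W t = G t \<union> (\<Union>u\<in>A `` {t}. W u)" unfolding W_def by (rule UN_descendants)
    then have W: "W t = F t \<union> (\<Union>u\<in>A `` {t}. ?L u)" unfolding G_def by (auto simp: insert_commute)
    have empty: "branch c {} {}" for c :: 'a by (simp add: branch_def)
    have xC: "x t u \<in> C t" "e \<noteq> x t u" "finite (U u)" if "(t, u) \<in> A" for u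
      using link that 1 finU AN by auto
    have fin: "finite (A `` {t})" using \<open>finite A\<close> by (simp add: finite_Image)
    have "card (A `` {t}) \<le> 2" using tree tN unfolding binary_tree_def by blast
    then consider "card (A `` {t}) = 0" | "card (A `` {t}) = 1" | "card (A `` {t}) = 2" by linarith
    then show ?case
    proof cases
      case c: 1
      then have ch: "A `` {t} = {}" using fin by simp
      \<comment> \<open>At a leaf, any two further vertices of the cycle carry the empty
        branches.\<close>
      obtain a where a: "a \<in> C t" "a \<noteq> e" by (metis obtain_other finC(2) tN)
      obtain b where b: "b \<in> C t" "b \<noteq> e" "b \<noteq> a" by (metis obtain_other finC(2) tN)
      show ?thesis
        using hangable_cycle[OF cyc[OF tN] "1.prems"(2) a(1) b(1) a(2)[symmetric] b(2)[symmetric] b(3)[symmetric] empty empty]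
          U W ch by simp
    next
      case c: 2
      then obtain u where ch: "A `` {t} = {u}" by (auto simp: card_1_singleton_iff)
      then have u: "(t, u) \<in> A" by auto
      obtain b where b: "b \<in> C t" "b \<noteq> e" "b \<noteq> x t u" by (metis obtain_other finC(2) tN)
      show ?thesis
        using hangable_cycle[OF cyc[OF tN] "1.prems"(2) xC(1)[OF u] b(1) xC(2)[OF u] b(2)[symmetric] b(3)[symmetric] br[OF u] empty
            xC(3)[OF u]] CU[OF u] U W ch by simp
    next
      case c: 3
      then obtain u w where ch: "A `` {t} = {u, w}" "u \<noteq> w" by (auto simp: card_2_iff)
      then have u: "(t, u) \<in> A" "(t, w) \<in> A" by auto
      show ?thesis
        using hangable_cycle[OF cyc[OF tN] "1.prems"(2) xC(1)[OF u(1)] xC(1)[OF u(2)] xC(2)[OF u(1)] xC(2)[OF u(2)]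
            m1[OF u ch(2)] br[OF u(1)] br[OF u(2)] xC(3)[OF u(1)] xC(3)[OF u(2)] CU[OF u(1)] CU[OF u(2)]
            UU[OF u ch(2)]] U W ch(1) by (simp add: Un_assoc)
    qed
  qed
  then show ?thesis unfolding U_def W_def G_def .
qed

section \<open>Geometry of elbows: from separated ports to the drawing\<close>

lemma closed_segment_horizontal:
  "z \<in> closed_segment (a, c) (b, c) \<longleftrightarrow> snd z = c \<and> fst z \<in> closed_segment a b"
  for a b c :: real
proof -
  have "(1 - u) *\<^sub>R (a, c) + u *\<^sub>R (b, c) = ((1 - u) *\<^sub>R a + u *\<^sub>R b, c)" for u
    by (simp add: algebra_simps)
  then show ?thesis unfolding in_segment by (cases z) auto
qed

lemma closed_segment_vertical:
  "z \<in> closed_segment (c, a) (c, b) \<longleftrightarrow> fst z = c \<and> snd z \<in> closed_segment a b"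
  for a b c :: real
proof -
  have "(1 - u) *\<^sub>R (c, a) + u *\<^sub>R (c, b) = (c, (1 - u) *\<^sub>R a + u *\<^sub>R b)" for u
    by (simp add: algebra_simps)
  then show ?thesis unfolding in_segment by (cases z) auto
qed

text \<open>Horizontal at \<open>p\<close> and vertical at \<open>q\<close>, as a pair of
  \<open>R\<close> prescribes when \<open>X\<close> is \<open>fst\<close> and \<open>Y\<close> is
  \<open>snd\<close>.\<close>

definition elbow :: "point \<Rightarrow> point \<Rightarrow> point list" where
  "elbow p q = [p, (fst q, snd p), q]"

lemma elbow_segments: "segments (elbow p q) = [(p, (fst q, snd p)), ((fst q, snd p), q)]"
  by (simp add: elbow_def segments_def)

lemma elbow_bends: "bends (elbow p q) = [(fst q, snd p)]"
  by (simp add: elbow_def bends_def)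

lemma elbow_horizontal_part:
  "z \<in> closed_segment p (fst q, snd p) \<longleftrightarrow> snd z = snd p \<and> fst z \<in> closed_segment (fst p) (fst q)"
  for p q z :: point
  using closed_segment_horizontal[of z "fst p" "snd p" "fst q"] by simp

lemma elbow_vertical_part:
  "z \<in> closed_segment (fst q, snd p) q \<longleftrightarrow> fst z = fst q \<and> snd z \<in> closed_segment (snd p) (snd q)"
  for p q z :: point
  using closed_segment_vertical[of z "fst q" "snd p" "snd q"] by simp

lemma elbow_curve:
  "z \<in> curve (elbow p q) \<longleftrightarrow>
     snd z = snd p \<and> fst z \<in> closed_segment (fst p) (fst q) \<or>
     fst z = fst q \<and> snd z \<in> closed_segment (snd p) (snd q)"
  unfolding curve_def elbow_segments by (auto simp: elbow_horizontal_part elbow_vertical_part)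

lemma polygonal_chain_elbow:
  assumes "fst p \<noteq> fst q" "snd p \<noteq> snd q"
  shows "polygonal_chain (elbow p q)"
proof -
  have "closed_segment (elbow p q ! i) (elbow p q ! Suc i) \<inter>
      closed_segment (elbow p q ! j) (elbow p q ! Suc j) \<subseteq> (if j = Suc i then {elbow p q ! j} else {})"
    if "i < j" "Suc j < length (elbow p q)" for i j
  proof -
    have "i = 0" "j = 1" using that by (auto simp: elbow_def)
    then show ?thesis
      by (auto simp: elbow_def elbow_horizontal_part elbow_vertical_part prod_eq_iff)
  qed
  moreover have "distinct (elbow p q)" using assms by (auto simp: elbow_def prod_eq_iff)
  ultimately show ?thesis unfolding polygonal_chain_def by (auto simp: elbow_def)
qed

text \<open>Translates the sign condition of \<open>separated_ports\<close> into geometry: collinear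
  parts leaving \<open>c\<close> through opposite ports share only \<open>c\<close>.\<close>

lemma closed_segment_opposite_sides:
  fixes c :: real
  assumes "(a - c) * (b - c) < 0" "z \<in> closed_segment c a" "z \<in> closed_segment c b"
  shows "z = c"
  using assms by (auto simp: closed_segment_eq_real_ivl mult_less_0_iff split: if_splits)

text \<open>The inequations keep \<open>z\<close> away from the ends of the horizontal part of one
  elbow and the vertical part of the other. Both orders are stated because either edge may
  contribute the horizontal part.\<close>

lemma elbow_crossing:
  assumes z: "snd z = snd p" "fst z \<in> closed_segment (fst p) (fst q)"
      "fst z = fst q'" "snd z \<in> closed_segment (snd p') (snd q')"
    and "fst z \<noteq> fst p" "fst z \<noteq> fst q" "snd z \<noteq> snd p'" "snd z \<noteq> snd q'"
  shows "right_angle_crossing (elbow p q) (elbow p' q') z"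
    "right_angle_crossing (elbow p' q') (elbow p q) z"
proof -
  have "z \<in> open_segment p (fst q, snd p)" "z \<in> open_segment (fst q', snd p') q'"
    using assms by (auto simp: open_segment_def elbow_horizontal_part elbow_vertical_part)
  moreover have "((fst q, snd p) - p) \<bullet> (q' - (fst q', snd p')) = 0"
    "(q' - (fst q', snd p')) \<bullet> ((fst q, snd p) - p) = 0"
    by (simp_all add: inner_prod_def)
  ultimately show "right_angle_crossing (elbow p q) (elbow p' q') z"
    "right_angle_crossing (elbow p' q') (elbow p q) z"
    unfolding right_angle_crossing_def elbow_segments by auto
qed

lemma separated_ports_RAC1:
  assumes E: "simple_graph V E" and S: "grid_point_set n S" and bij: "bij_betw \<mu> V S"
    and R: "R \<subseteq> V \<times> V" "E = (\<lambda>(u, v). {u, v}) ` R" and sep: "separated_ports fst snd \<mu> R"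
  shows "\<exists>D. restricted_RAC1_embedding V E S \<mu> D"
proof -
  \<comment> \<open>One pair of \<open>R\<close> is chosen for each edge; \<open>s e\<close> will be
    its horizontal end and \<open>t e\<close> its vertical end.\<close>
  have "\<forall>e\<in>E. \<exists>r. r \<in> R \<and> e = {fst r, snd r}" using R(2) by auto
  then obtain c where c: "\<And>e. e \<in> E \<Longrightarrow> c e \<in> R \<and> e = {fst (c e), snd (c e)}" by metis
  define s t where "s e = fst (c e)" and "t e = snd (c e)" for e
  have st: "(s e, t e) \<in> R" "e = {s e, t e}" if "e \<in> E" for e using c[OF that] by (auto simp: s_def t_def)
  have stV: "s e \<in> V" "t e \<in> V" if "e \<in> E" for e using st(1)[OF that] R(1) by auto
  have ne: "s e \<noteq> t e" if "e \<in> E" for e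
  proof -
    have "card e = 2" using E that by (auto simp: simple_graph_def)
    then show ?thesis using st(2)[OF that] by (metis card_2_iff doubleton_eq_iff insert_absorb2)
  qed
  have mS: "\<mu> v \<in> S" if "v \<in> V" for v using bij that by (auto simp: bij_betw_def)
  have minj: "u = v" if "\<mu> u = \<mu> v" "u \<in> V" "v \<in> V" for u v
    using bij that by (auto simp: bij_betw_def dest: inj_onD)
  have fi: "fst (\<mu> u) = fst (\<mu> v) \<longleftrightarrow> u = v" "snd (\<mu> u) = snd (\<mu> v) \<longleftrightarrow> u = v"
    if "u \<in> V" "v \<in> V" for u v
    using S mS that minj unfolding grid_point_set_def by (meson inj_onD)+
  define D where "D e = elbow (\<mu> (s e)) (\<mu> (t e))" for e
  have hh: "fst z = fst (\<mu> (s e))" if "e \<in> E" "f \<in> E" "s e = s f" "t e \<noteq> t f"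
    "fst z \<in> closed_segment (fst (\<mu> (s e))) (fst (\<mu> (t e)))"
    "fst z \<in> closed_segment (fst (\<mu> (s f))) (fst (\<mu> (t f)))" for e f and z :: point
  proof -
    have "(s e, t e) \<in> R" "(s e, t f) \<in> R" using st(1) that by metis+
    then have "(fst (\<mu> (t e)) - fst (\<mu> (s e))) * (fst (\<mu> (t f)) - fst (\<mu> (s e))) < 0"
      using sep that(4) unfolding separated_ports_def by blast
    then show ?thesis by (rule closed_segment_opposite_sides) (use that in auto)
  qed
  have vv: "snd z = snd (\<mu> (t e))" if "e \<in> E" "f \<in> E" "t e = t f" "s e \<noteq> s f"
    "snd z \<in> closed_segment (snd (\<mu> (s e))) (snd (\<mu> (t e)))"
    "snd z \<in> closed_segment (snd (\<mu> (s f))) (snd (\<mu> (t f)))" for e f and z :: point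
  proof -
    have "(s e, t e) \<in> R" "(s f, t e) \<in> R" using st(1) that by metis+
    then have "(snd (\<mu> (s e)) - snd (\<mu> (t e))) * (snd (\<mu> (s f)) - snd (\<mu> (t e))) < 0"
      using sep that(4) unfolding separated_ports_def by blast
    then show ?thesis
      by (rule closed_segment_opposite_sides) (use that in \<open>auto simp: closed_segment_commute\<close>)
  qed
  have diff: "s e \<noteq> s f \<or> t e \<noteq> t f" if "e \<in> E" "f \<in> E" "e \<noteq> f" for e f using st(2) that by metis
  have hv: "right_angle_crossing (D e) (D f) z \<and> right_angle_crossing (D f) (D e) z"
    if ef: "e \<in> E" "f \<in> E" "e \<noteq> f" and z: "z \<notin> \<mu> ` (e \<inter> f)"
      "snd z = snd (\<mu> (s e))" "fst z \<in> closed_segment (fst (\<mu> (s e))) (fst (\<mu> (t e)))"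
      "fst z = fst (\<mu> (t f))" "snd z \<in> closed_segment (snd (\<mu> (s f))) (snd (\<mu> (t f)))" for e f z
  proof -
    have nef: "s e \<noteq> t f"
    proof
      assume eq: "s e = t f"
      then have "z = \<mu> (s e)" using z by (simp add: prod_eq_iff)
      moreover have "s e \<in> e" "s e \<in> f" using st(2)[OF ef(1)] st(2)[OF ef(2)] eq by auto
      ultimately show False using z(1) by blast
    qed
    note V = stV[OF ef(1)] stV[OF ef(2)]
    have 1: "fst z \<noteq> fst (\<mu> (s e))" using z(4) fi(1) V nef by auto
    have 2: "snd z \<noteq> snd (\<mu> (t f))" using z(2) fi(2) V nef by auto
    \<comment> \<open>If \<open>z\<close> were the bend of \<open>e\<close>, both edges would be
      vertical at the same vertex, and opposite ports would force \<open>z\<close> to be that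
      vertex, contrary to \<open>2\<close>. The bend of \<open>f\<close> is excluded
      likewise.\<close>
    have 3: "fst z \<noteq> fst (\<mu> (t e))"
    proof
      assume "fst z = fst (\<mu> (t e))"
      then have "t e = t f" using z(4) fi(1) V by auto
      then have "snd z = snd (\<mu> (t e))"
        using vv[of e f z] z diff[OF ef] ef by auto
      then show False using 2 \<open>t e = t f\<close> by simp
    qed
    have 4: "snd z \<noteq> snd (\<mu> (s f))"
    proof
      assume "snd z = snd (\<mu> (s f))"
      then have "s e = s f" using z(2) fi(2) V by auto
      then have "fst z = fst (\<mu> (s e))"
        using hh[of e f z] z diff[OF ef] ef by auto
      then show False using 1 by simp
    qed
    show ?thesis unfolding D_def using elbow_crossing[OF z(2-5) 1 3 4 2] by blast
  qed
  \<comment> \<open>Two parallel parts on the same line start in a common vertex, which they leave through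
    opposite ports; so they share nothing else.\<close>
  have meet: "snd z = snd (\<mu> (s e)) \<and> fst z \<in> closed_segment (fst (\<mu> (s e))) (fst (\<mu> (t e))) \<and>
      fst z = fst (\<mu> (t f)) \<and> snd z \<in> closed_segment (snd (\<mu> (s f))) (snd (\<mu> (t f))) \<or>
      snd z = snd (\<mu> (s f)) \<and> fst z \<in> closed_segment (fst (\<mu> (s f))) (fst (\<mu> (t f))) \<and>
      fst z = fst (\<mu> (t e)) \<and> snd z \<in> closed_segment (snd (\<mu> (s e))) (snd (\<mu> (t e)))"
    if ef: "e \<in> E" "f \<in> E" "e \<noteq> f" and z: "z \<in> curve (D e) \<inter> curve (D f) - \<mu> ` (e \<inter> f)" for e f z
  proof -
    note V = stV[OF ef(1)] stV[OF ef(2)]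
    have z': "z \<notin> \<mu> ` (e \<inter> f)" "z \<notin> \<mu> ` (f \<inter> e)" using z by auto
    have nhh: False if h: "snd z = snd (\<mu> (s e))" "fst z \<in> closed_segment (fst (\<mu> (s e))) (fst (\<mu> (t e)))"
      "snd z = snd (\<mu> (s f))" "fst z \<in> closed_segment (fst (\<mu> (s f))) (fst (\<mu> (t f)))"
    proof -
      have eq: "s e = s f" using h fi(2) V by auto
      then have "fst z = fst (\<mu> (s e))" using hh[of e f z] h diff[OF ef] ef by auto
      then have "z = \<mu> (s e)" using h by (simp add: prod_eq_iff)
      moreover have "s e \<in> e" "s e \<in> f" using st(2)[OF ef(1)] st(2)[OF ef(2)] eq by auto
      ultimately show False using z' by blast
    qed
    have nvv: False if h: "fst z = fst (\<mu> (t e))" "snd z \<in> closed_segment (snd (\<mu> (s e))) (snd (\<mu> (t e)))"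
      "fst z = fst (\<mu> (t f))" "snd z \<in> closed_segment (snd (\<mu> (s f))) (snd (\<mu> (t f)))"
    proof -
      have eq: "t e = t f" using h fi(1) V by auto
      then have "snd z = snd (\<mu> (t e))" using vv[of e f z] h diff[OF ef] ef by auto
      then have "z = \<mu> (t e)" using h by (simp add: prod_eq_iff)
      moreover have "t e \<in> e" "t e \<in> f" using st(2)[OF ef(1)] st(2)[OF ef(2)] eq by auto
      ultimately show False using z' by blast
    qed
    have "z \<in> curve (D e)" "z \<in> curve (D f)" using z by auto
    then show ?thesis unfolding D_def elbow_curve using nhh nvv by blast
  qed
  have cross: "right_angle_crossing (D e) (D f) z"
    if ef: "e \<in> E" "f \<in> E" "e \<noteq> f" and z: "z \<in> curve (D e) \<inter> curve (D f) - \<mu> ` (e \<inter> f)" for e f z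
  proof -
    have z': "z \<notin> \<mu> ` (e \<inter> f)" "z \<notin> \<mu> ` (f \<inter> e)" using z by auto
    show ?thesis using meet[OF that] hv[OF ef z'(1)] hv[OF ef(2,1) ef(3)[symmetric] z'(2)] by blast
  qed
  have noover: "\<not> overlap (D e) (D f)" if ef: "e \<in> E" "f \<in> E" "e \<noteq> f" for e f
  proof
    assume "overlap (D e) (D f)"
    then obtain a b where ab: "a \<noteq> b" "closed_segment a b \<subseteq> curve (D e) \<inter> curve (D f)"
      unfolding overlap_def by blast
    \<comment> \<open>Two edges share only finitely many points, whereas a nondegenerate segment is
      infinite.\<close>
    have "curve (D e) \<inter> curve (D f) \<subseteq> \<mu> ` (e \<inter> f) \<union>
        {(fst (\<mu> (t f)), snd (\<mu> (s e))), (fst (\<mu> (t e)), snd (\<mu> (s f)))}" (is "_ \<subseteq> ?T")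
    proof
      fix z assume z: "z \<in> curve (D e) \<inter> curve (D f)"
      show "z \<in> ?T"
      proof (cases "z \<in> \<mu> ` (e \<inter> f)")
        case False
        then show ?thesis using meet[OF ef, of z] z by (auto simp: prod_eq_iff)
      qed auto
    qed
    then have "closed_segment a b \<subseteq> ?T" by (rule subset_trans[OF ab(2)])
    moreover have "finite e" using st(2)[OF ef(1)] by (metis finite.emptyI finite.insertI)
    then have "finite ?T" by simp
    ultimately have "finite (closed_segment a b)" by (rule finite_subset)
    then show False using ab(1) by (simp add: finite_closed_segment)
  qed
  have chain: "polygonal_chain (D e) \<and> {hd (D e), last (D e)} = \<mu> ` e" if e: "e \<in> E" for e
  proof -
    have "polygonal_chain (D e)" unfolding D_def
      by (rule polygonal_chain_elbow) (use fi[OF stV[OF e]] ne[OF e] in auto)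
    moreover have "{hd (D e), last (D e)} = \<mu> ` {s e, t e}" by (simp add: D_def elbow_def)
    ultimately show ?thesis using st(2)[OF e] by simp
  qed
  have avoid: "\<mu> v \<notin> curve (D e)" if "e \<in> E" "v \<in> V - e" for e v
  proof -
    have "v \<noteq> s e" "v \<noteq> t e" using st(2)[OF that(1)] that(2) by auto
    then show ?thesis unfolding D_def elbow_curve using fi stV[OF that(1)] that(2) by auto
  qed
  \<comment> \<open>A bend takes each coordinate from a vertex, hence is a grid point.\<close>
  have int: "fst (\<mu> v) \<in> \<int>" "snd (\<mu> v) \<in> \<int>" if "v \<in> V" for v
  proof -
    have "\<mu> v \<in> real ` {1..n} \<times> real ` {1..n}"
      using mS[OF that] S unfolding grid_point_set_def by blast
    then show "fst (\<mu> v) \<in> \<int>" "snd (\<mu> v) \<in> \<int>" by (auto simp: mem_Times_iff)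
  qed
  have "point_set_embedding V E S \<mu> D"
    unfolding point_set_embedding_def using bij chain noover avoid by blast
  moreover have "fst a = fst b \<or> snd a = snd b" if "(a, b) \<in> set (segments (D e))" for a b e
    using that by (auto simp: D_def elbow_segments)
  moreover have "length (bends (D e)) \<le> 1" for e by (simp add: D_def elbow_bends)
  moreover have "fst b \<in> \<int> \<and> snd b \<in> \<int>" if "e \<in> E" "b \<in> set (bends (D e))" for b e
    using that int stV by (simp add: D_def elbow_bends)
  ultimately have "restricted_RAC1_embedding V E S \<mu> D"
    unfolding restricted_RAC1_embedding_def using cross by blast
  then show ?thesis by blast
qed

section \<open>Distinct attachment vertices from the degree bound, and the conclusion\<close>

theorem theorem2:
  fixes N :: "'t set" and r :: 't and A :: "('t \<times> 't) set"
    and V :: "'a set" and E :: "'a set set"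
    and n :: nat and S :: "(real \<times> real) set"
  assumes "binary_tree N r A"
    and "simple_graph V E"
    and "card V = n"
    and "arises_by_cycle_replacement N A V E"
    and "\<forall>v\<in>V. vertex_degree E v \<le> 3"
    and "grid_point_set n S"
  shows "\<exists>\<mu> D. restricted_RAC1_embedding V E S \<mu> D"
proof -
  note tree = assms(1)
  from assms(4) obtain C F x y where
    cyc: "\<And>t. t \<in> N \<Longrightarrow> is_cycle (C t) (F t)" and disj: "disjoint_family_on C N"
    and link: "\<And>s t. (s, t) \<in> A \<Longrightarrow> x s t \<in> C s \<and> y s t \<in> C t"
    and V: "V = (\<Union>t\<in>N. C t)"
    and E: "E = (\<Union>t\<in>N. F t) \<union> {{x s t, y s t} | s t. (s, t) \<in> A}"
    unfolding arises_by_cycle_replacement_def by (elim exE conjE) (rule that, auto)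
  have AN: "A \<subseteq> N \<times> N" using tree by (simp add: binary_tree_def)
  have E_sub: "E \<subseteq> Pow V" and finV: "finite V" using assms(2) by (auto simp: simple_graph_def)
  then have finE: "finite E" using finite_subset by blast
  have ac: "(s, s) \<notin> A\<^sup>+" for s using binary_tree_acyclic[OF tree] by (simp add: acyclic_def)
  have CC: "C s \<inter> C t = {}" if "s \<in> N" "t \<in> N" "s \<noteq> t" for s t
    using disj that unfolding disjoint_family_on_def by blast
  have LE: "{x s t, y s t} \<in> E" if "(s, t) \<in> A" for s t using E that by blast
  \<comment> \<open>Two edges leaving the cycle at one vertex would give it degree at least 4. Links
    to different cycles are such edges, which yields \<open>m1\<close> and
    \<open>m2\<close>.\<close>
  have mid: False
    if "t \<in> N" "v \<in> C t" "e \<in> E" "e' \<in> E" "e \<noteq> e'" "v \<in> e" "v \<in> e'" "\<not> e \<subseteq> C t" "\<not> e' \<subseteq> C t"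
    for t v e e'
  proof -
    have "F t \<subseteq> E" using that(1) E by blast
    then have "vertex_degree E v \<ge> 4"
      using vertex_degree_cycle_plus_two[OF cyc[OF that(1)] finE _ that(2-)] by blast
    moreover have "v \<in> V" using that V by blast
    ultimately show False using assms(5) by fastforce
  qed
  have m1: "x t u \<noteq> x t w" if A: "(t, u) \<in> A" "(t, w) \<in> A" "u \<noteq> w" for t u w
  proof
    assume eq: "x t u = x t w"
    have N: "t \<in> N" "u \<in> N" "w \<in> N" using A AN by auto
    have ne: "t \<noteq> u" "t \<noteq> w" using ac A by auto
    note C = link[OF A(1)] link[OF A(2)] CC[OF N(1,2) ne(1)] CC[OF N(1,3) ne(2)] CC[OF N(2,3) A(3)]
    show False
      by (rule mid[OF N(1), of "x t u" "{x t u, y t u}" "{x t w, y t w}"])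
         (use C eq LE[OF A(1)] LE[OF A(2)] in \<open>auto simp: doubleton_eq_iff\<close>)
  qed
  have m2: "y s t \<noteq> x t u" if A: "(s, t) \<in> A" "(t, u) \<in> A" for s t u
  proof
    assume eq: "y s t = x t u"
    have N: "s \<in> N" "t \<in> N" "u \<in> N" using A AN by auto
    have ne: "s \<noteq> t" "t \<noteq> u" "s \<noteq> u" using ac A by (auto dest: trancl_trans[OF r_into_trancl r_into_trancl])
    note C = link[OF A(1)] link[OF A(2)] CC[OF N(1,2) ne(1)] CC[OF N(2,3) ne(2)] CC[OF N(1,3) ne(3)]
    show False
      by (rule mid[OF N(2), of "y s t" "{x s t, y s t}" "{x t u, y t u}"])
         (use C eq LE[OF A(1)] LE[OF A(2)] in \<open>auto simp: doubleton_eq_iff\<close>)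
  qed
  have rN: "r \<in> N" and ch: "card (A `` {r}) \<le> 2" and reach: "\<And>t. t \<in> N \<Longrightarrow> (r, t) \<in> A\<^sup>*"
    and finN: "finite N" using tree by (auto simp: binary_tree_def)
  have desc: "A\<^sup>* `` {r} = N"
  proof -
    have "s \<in> N" if "(r, s) \<in> A\<^sup>*" for s using that rN AN by (induction rule: rtrancl_induct) auto
    then show ?thesis using reach by auto
  qed
  have "finite (A `` {r})" using AN finN by (auto intro: finite_subset[of _ N])
  then have "card (x r ` (A `` {r})) \<le> 2" using ch card_image_le le_trans by blast
  moreover have "card (C r) \<ge> 3" using is_cycle_card(2)[OF cyc[OF rN]] .
  \<comment> \<open>At most two of the at least three vertices of the root cycle carry links, so a
    vertex \<open>e\<close> remains to play the part of \<open>y\<close>.\<close>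
  ultimately have "\<not> C r \<subseteq> x r ` (A `` {r})"
    using \<open>finite (A `` {r})\<close> card_mono[of "x r ` (A `` {r})" "C r"] by auto
  then obtain e where e: "e \<in> C r" "\<And>u. (r, u) \<in> A \<Longrightarrow> e \<noteq> x r u" by auto
  have "(\<Union>s\<in>N. F s \<union> (\<lambda>u. {x s u, y s u}) ` (A `` {s})) = E" unfolding E using AN by auto
  then have hang: "hangable V E e"
    using hangable_subtree[OF tree cyc disj link m1 m2 rN e] unfolding desc V by simp
  have S: "card S = card V" "inj_on fst S" "inj_on snd S" "S \<subseteq> real ` {1..n} \<times> real ` {1..n}"
    using assms(3,6) by (auto simp: grid_point_set_def)
  then have "finite S" by (auto intro: finite_subset)
  \<comment> \<open>The root has no parent to prescribe a level; 0 is admissible because all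
    coordinates are at least 1.\<close>
  moreover have "0 \<notin> snd ` S" using S(4) by auto
  ultimately obtain \<mu> R where "bij_betw \<mu> V S" "R \<subseteq> V \<times> V" "E = (\<lambda>(u, v). {u, v}) ` R"
    "separated_ports fst snd \<mu> R"
    using hang[unfolded hangable_def, rule_format, of S fst snd 0] S by blast
  then show ?thesis using separated_ports_RAC1[OF assms(2,6)] by blast
qed

end
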